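(* For every integer $k\ge 0$, $$\frac{\pi}{4}=2\arctan\left(\frac{1}{\phi^{2k}}\right)+\arctan\left(\frac{-2+(L_{2k}-2)\phi^{2k}}{-2+(L_{2k}+2)\phi^{2k}}\right).$$
   Context: $\phi=\frac{1+\sqrt5}{2}$ is the Golden mean. $(L_m)_{m\ge0}$ is the sequence of Lucas numbers: $L_0=2$, $L_1=1$, $L_m=L_{m-1}+L_{m-2}$ for $m\ge2$. *)

theory Defs
  imports Complex_Main
begin

definition golden_mean :: real where
  "golden_mean = (1 + sqrt 5) / 2"

fun lucas :: "nat \<Rightarrow> nat" where
  "lucas 0 = 2"
| "lucas (Suc 0) = 1"
| "lucas (Suc (Suc m)) = lucas (Suc m) + lucas m"

end

(* With x = phi^(2k) >= 1, Binet's formula gives L_(2k) x = x^2 + 1, so the last argument is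
   (x^2 - 2x - 1) / (x^2 + 2x - 1).  Put u = arctan (1/x).  Two applications of the addition
   formula give arctan ((x - 1)/(x + 1)) = pi/4 - u and then arctan of that argument = pi/4 - 2u. *)

theory Submission
  imports Defs
begin

lemma golden_mean_square: "golden_mean\<^sup>2 = golden_mean + 1"
  by (simp add: golden_mean_def power2_eq_square field_simps)

lemma golden_mean_ge_1: "golden_mean \<ge> 1"
  by (simp add: golden_mean_def)

text \<open>Both \<open>golden_mean\<close> and its conjugate \<open>1 - golden_mean\<close> are
  roots of \<open>r\<^sup>2 = r + 1\<close>, so their powers obey the Lucas recurrence.\<close>

lemma lucas_binet: "real (lucas n) = golden_mean ^ n + (1 - golden_mean) ^ n"
proof (induction n rule: lucas.induct)
  case (3 m)
  have "r ^ Suc (Suc m) = r ^ Suc m + r ^ m" if "r\<^sup>2 = r + 1" for r :: real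
    using that by (simp add: power2_eq_square algebra_simps flip: mult.assoc)
  from this[of golden_mean] this[of "1 - golden_mean"] 3 show ?case
    using golden_mean_square by (simp add: power2_eq_square algebra_simps)
qed simp_all

text \<open>The two roots have product -1, so their even powers are reciprocal and the conjugate
  term of Binet's formula contributes exactly 1.\<close>

lemma lucas_even_mult_golden_mean_power:
  "real (lucas (2 * k)) * golden_mean ^ (2 * k) = (golden_mean ^ (2 * k))\<^sup>2 + 1"
proof -
  have "(1 - golden_mean) * golden_mean = -1"
    using golden_mean_square by (simp add: power2_eq_square algebra_simps)
  then have "(1 - golden_mean) ^ (2 * k) * golden_mean ^ (2 * k) = 1"
    by (simp flip: power_mult_distrib)
  then show ?thesis
    by (simp add: lucas_binet distrib_right power2_eq_square)
qed

lemma pi_quarter_eq_two_arctan_inverse_add_arctan: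
  fixes x :: real
  assumes "x \<ge> 1"
  shows "pi / 4 = 2 * arctan (1 / x) + arctan ((x\<^sup>2 - 2 * x - 1) / (x\<^sup>2 + 2 * x - 1))"
proof -
  define t where "t = (x - 1) / (x + 1)"
  \<comment> \<open>\<open>arctan_add\<close> allows equality in only one of its two bounds. It goes
    to \<open>1 / x\<close>, which equals 1 when x = 1 (the case k = 0); \<open>t\<close> stays
    strictly inside.\<close>
  have x: "\<bar>1 / x\<bar> \<le> 1" and t: "\<bar>t\<bar> < 1"
    using assms by (auto simp: t_def field_simps)
  have pos: "x\<^sup>2 + 2 * x - 1 > 0"
    using one_le_power[OF assms, of 2] assms by linarith
  have nz: "x \<noteq> 0" "x + 1 \<noteq> 0"
    using assms by auto
  \<comment> \<open>Numerator and denominator of the addition formula coincide, so the sum of the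
    angles has tangent 1.\<close>
  have "1 / x + t = (x\<^sup>2 + 1) / (x * (x + 1))"
    and "1 - 1 / x * t = (x\<^sup>2 + 1) / (x * (x + 1))"
    using nz by (simp_all add: t_def divide_simps power2_eq_square) algebra+
  moreover have "x\<^sup>2 + 1 \<noteq> 0"
    using zero_le_power2[of x] by linarith
  ultimately have "(1 / x + t) / (1 - 1 / x * t) = 1"
    using nz by simp
  then have sum: "arctan (1 / x) + arctan t = pi / 4"
    using arctan_add[OF x t] by (simp only: arctan_one)
  \<comment> \<open>Second use of the addition formula, at \<open>- (1 / x)\<close> since arctan is
    odd; the common factor \<open>x * (x + 1)\<close> cancels in the quotient.\<close>
  have "- (1 / x) + t = (x\<^sup>2 - 2 * x - 1) / (x * (x + 1))"
    and "1 - - (1 / x) * t = (x\<^sup>2 + 2 * x - 1) / (x * (x + 1))"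
    using nz by (simp_all add: t_def divide_simps power2_eq_square) algebra+
  then have "(- (1 / x) + t) / (1 - - (1 / x) * t)
      = (x\<^sup>2 - 2 * x - 1) / (x\<^sup>2 + 2 * x - 1)"
    using assms pos by simp
  then have "arctan t - arctan (1 / x) = arctan ((x\<^sup>2 - 2 * x - 1) / (x\<^sup>2 + 2 * x - 1))"
    using arctan_add[of "- (1 / x)" t] x t by (simp add: arctan_minus)
  with sum show ?thesis
    by linarith
qed

theorem mainTheorem5:
  fixes k :: nat
  shows "pi / 4 = 2 * arctan (1 / golden_mean ^ (2 * k))
    + arctan ((- 2 + (real (lucas (2 * k)) - 2) * golden_mean ^ (2 * k))
            / (- 2 + (real (lucas (2 * k)) + 2) * golden_mean ^ (2 * k)))"
proof -
  define x where "x = golden_mean ^ (2 * k)"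
  have L: "real (lucas (2 * k)) * x = x\<^sup>2 + 1"
    unfolding x_def by (rule lucas_even_mult_golden_mean_power)
  \<comment> \<open>The 1 in \<open>L\<close> turns the constant -2 into -1.\<close>
  have "- 2 + (real (lucas (2 * k)) - 2) * x = x\<^sup>2 - 2 * x - 1"
    and "- 2 + (real (lucas (2 * k)) + 2) * x = x\<^sup>2 + 2 * x - 1"
    using L by (simp_all add: algebra_simps)
  moreover have "x \<ge> 1"
    unfolding x_def by (rule one_le_power[OF golden_mean_ge_1])
  ultimately show ?thesis
    using pi_quarter_eq_two_arctan_inverse_add_arctan[of x] by (simp flip: x_def)
qed

end
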